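(* Let $(S_O,P_O)$ be a deductive source with irredundant core $A=\mathrm{Atom}(S_O)$ and reconstruction alphabet $\hat S_O$. Assume $A\neq\varnothing$ and that either ($P_A=0$ and $\hat S_O\cap\mathrm{Cn}(S_O)\neq\varnothing$) or ($P_A>0$ and $R_{\mathrm{Cn}}(a)\neq\varnothing$ for every $a\in A$). Then $$R_{\mathrm{sem}}(0;d_{\mathrm{Cn}},P_O)=P_A\,H_{\Gamma_0}(\pi_A),$$ with the convention that the right-hand side is $0$ when $P_A=0$.
   Context: Setting. $\mathbb{S}_O$ is a finite set of statements with a fixed proof system with decidable derivability; $\mathrm{Cn}(\Gamma)\subseteq\mathbb{S}_O$ denotes the set of statements derivable from $\Gamma\subseteq\mathbb{S}_O$. $\mathrm{Cn}$ is reflexive ($\Gamma\subseteq\mathrm{Cn}(\Gamma)$), monotone ($\Gamma\subseteq\Gamma'\Rightarrow\mathrm{Cn}(\Gamma)\subseteq\mathrm{Cn}(\Gamma')$) and idempotent. $S_O\subseteq\mathbb{S}_O$ is a finite knowledge base with a fixed linear (canonical) order, $\hat S_O\subseteq\mathbb{S}_O$ is a nonempty finite reconstruction alphabet, and a deductive source is a pair $(S_O,P_O)$ with $P_O$ a probability distribution on $S_O$. Core. $\mathrm{Atom}(S_O)$ is the output of the deletion procedure: start with $B=S_O$; scan the elements $s$ of $S_O$ in the canonical order; whenever the scanned $s$ satisfies $s\in\mathrm{Cn}(B\setminus\{s\})$ for the current $B$, remove $s$ from $B$; the final $B$ is $\mathrm{Atom}(S_O)$. Put $A=\mathrm{Atom}(S_O)$,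 $P_A=P_O(A)$ and, if $P_A>0$, $\pi_A(a)=P_O(a)/P_A$ for $a\in A$. Closure distortion. For $s\in S_O$, $\hat s\in\mathbb{S}_O$, let $C_s=\mathrm{Cn}(S_O)$ and $C_{\hat s}=\mathrm{Cn}((S_O\setminus\{s\})\cup\{\hat s\})$; then $d_{\mathrm{Cn}}(s,\hat s)=d_{\mathrm{Cn}}(s,\hat s\mid S_O)=1-|C_s\cap C_{\hat s}|/|C_s\cup C_{\hat s}|$, with $0/0$ giving distortion $0$. For $s\in S_O$, $R_{\mathrm{Cn}}(s)=\{\hat s\in\hat S_O: d_{\mathrm{Cn}}(s,\hat s\mid S_O)=0\}$. Rate–distortion function. $R_{\mathrm{sem}}(D;d_{\mathrm{Cn}},P_O)$ is the minimum of the mutual information $I(\mathsf S_o;\hat{\mathsf S}_o)$ over all test channels $P_{\hat S\mid S}$ from $S_O$ to $\hat S_O$ with $\mathbb{E}[d_{\mathrm{Cn}}(\mathsf S_o,\hat{\mathsf S}_o)]\le D$, where $\mathsf S_o\sim P_O$ and $\hat{\mathsf S}_o\sim P_{\hat S\mid S}(\cdot\mid\mathsf S_o)$ (value $+\infty$ if no such channel exists). Hypergraph entropy. The core zero-distortion hypergraph is $\Gamma_0=\{W\subseteq A: W\neq\emptyset,\ \bigcap_{a\in W}R_{\mathrm{Cn}}(a)\neq\emptyset\}$. For $P_A>0$ and $\mathsf A_o\sim\pi_A$, $$H_{\Gamma_0}(\pi_A)=\min_{P_{W\mid A}} I(\mathsf A_o;W),$$ the minimum being over conditional laws of a random subset $W\subseteq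 A$ given $\mathsf A_o$ such that $\mathsf A_o\in W$ and $W\in\Gamma_0$ almost surely. *)

theory Defs
  imports "HOL-Probability.Probability"
begin

text \<open>
  The universe of statements is the (finite) type \<open>'a\<close>, and \<open>Cn\<close> is a function on sets of
  statements. A knowledge base with its canonical order is a list \<open>ss\<close> without repetitions:
  \<open>set ss\<close> is the knowledge base and the order of the list is the canonical order.
\<close>

definition Atom :: "('a set \<Rightarrow> 'a set) \<Rightarrow> 'a list \<Rightarrow> 'a set" where
  "Atom Cn ss = fold (\<lambda>s B. if s \<in> Cn (B - {s}) then B - {s} else B) ss (set ss)"

text \<open>The case distinction is needed because in HOL \<open>1 - 0 / 0 = 1\<close>.\<close>

definition closure_distortion :: "('a set \<Rightarrow> 'a set) \<Rightarrow> 'a set \<Rightarrow> 'a \<Rightarrow> 'a \<Rightarrow> real" where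
  "closure_distortion Cn S s s' =
     (let C = Cn S; C' = Cn ((S - {s}) \<union> {s'})
      in if C \<union> C' = {} then 0 else 1 - real (card (C \<inter> C')) / real (card (C \<union> C')))"

definition zero_distortion_set :: "('a set \<Rightarrow> 'a set) \<Rightarrow> 'a set \<Rightarrow> 'a set \<Rightarrow> 'a \<Rightarrow> 'a set" where
  "zero_distortion_set Cn S S' s = {s' \<in> S'. closure_distortion Cn S s s' = 0}"

definition channel_joint :: "'b pmf \<Rightarrow> ('b \<Rightarrow> 'c pmf) \<Rightarrow> ('b \<times> 'c) pmf" where
  "channel_joint P K = bind_pmf P (\<lambda>x. map_pmf (Pair x) (K x))"

text \<open>Mutual information of input and output, with logarithms to base \<open>b\<close>.\<close>

definition channel_information ::
  "real \<Rightarrow> ('b::finite) pmf \<Rightarrow> ('b \<Rightarrow> ('c::finite) pmf) \<Rightarrow> real" where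
  "channel_information b P K =
     prob_space.mutual_information (measure_pmf (channel_joint P K)) b
       (count_space UNIV) (count_space UNIV) fst snd"

text \<open>
  \<open>LEAST\<close> denotes the minimum. It is attained for the sets of channels used below
  whenever they are nonempty, as these are compact and mutual information is continuous.
\<close>

definition min_information ::
  "real \<Rightarrow> ('b::finite) pmf \<Rightarrow> ('b \<Rightarrow> ('c::finite) pmf) set \<Rightarrow> real" where
  "min_information b P F = (LEAST r. \<exists>K\<in>F. r = channel_information b P K)"

text \<open>
  Channels are total functions on the type; only their values on the source alphabet \<open>S\<close>
  (or \<open>A\<close>, for the hypergraph entropy) are constrained or relevant.
\<close>

definition test_channels ::
  "'a set \<Rightarrow> 'a set \<Rightarrow> ('a \<Rightarrow> 'a \<Rightarrow> real) \<Rightarrow> 'a pmf \<Rightarrow> real \<Rightarrow> ('a \<Rightarrow> 'a pmf) set" where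
  "test_channels S S' d P D =
     {K. (\<forall>s\<in>S. set_pmf (K s) \<subseteq> S') \<and>
         measure_pmf.expectation (channel_joint P K) (\<lambda>(s, s'). d s s') \<le> D}"

definition rate_distortion ::
  "real \<Rightarrow> ('a::finite) set \<Rightarrow> 'a set \<Rightarrow> ('a \<Rightarrow> 'a \<Rightarrow> real) \<Rightarrow> 'a pmf \<Rightarrow> real \<Rightarrow> ereal" where
  "rate_distortion b S S' d P D =
     (if test_channels S S' d P D = {} then \<infinity>
      else ereal (min_information b P (test_channels S S' d P D)))"

definition zero_distortion_hypergraph :: "'a set \<Rightarrow> ('a \<Rightarrow> 'a set) \<Rightarrow> 'a set set" where
  "zero_distortion_hypergraph A R = {W. W \<subseteq> A \<and> W \<noteq> {} \<and> (\<Inter>a\<in>W. R a) \<noteq> {}}"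

definition subset_channels ::
  "'a set \<Rightarrow> 'a set set \<Rightarrow> 'a pmf \<Rightarrow> ('a \<Rightarrow> 'a set pmf) set" where
  "subset_channels A \<Gamma> \<pi> =
     {K. (\<forall>a\<in>A. set_pmf (K a) \<subseteq> Pow A) \<and>
         (AE (a, W) in measure_pmf (channel_joint \<pi> K). a \<in> W \<and> W \<in> \<Gamma>)}"

definition hypergraph_entropy ::
  "real \<Rightarrow> ('a::finite) set \<Rightarrow> 'a set set \<Rightarrow> 'a pmf \<Rightarrow> real" where
  "hypergraph_entropy b A \<Gamma> \<pi> = min_information b \<pi> (subset_channels A \<Gamma> \<pi>)"

end

theory Submission
  imports Defs "HOL-Real_Asymp.Real_Asymp"
begin

text \<open>
  A statement \<open>s\<close> outside the core is derivable from the others, so it tolerates every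
  reconstruction in \<open>S' \<inter> Cn S\<close>, which contains all \<open>R a\<close>. Hence a channel on the core can be
  extended to all of \<open>S\<close> by emitting, outside the core, its own output law: only the core,
  with weight \<open>PA\<close>, then carries information. Conversely, by nonnegativity of relative entropy
  and optimality of the output law, every channel carries at least \<open>PA\<close> times the information
  of its restriction to the core. On the core, a reconstruction \<open>t\<close> and the hyperedge
  \<open>{a \<in> A. t \<in> R a}\<close> are interchangeable by the data processing inequality. As the minimum is a
  \<open>LEAST\<close> over reals, its attainment is needed as well; it follows from compactness.
\<close>

section \<open>Relative entropy on finite types\<close>

text \<open>Natural logarithms are used; the base enters only as a final factor. The value is a
  real, so a letter charged by \<open>p\<close> but not by \<open>q\<close> cannot make it infinite;
  hence the support inclusions assumed below.\<close>

definition relative_entropy :: "('c::finite) pmf \<Rightarrow> 'c pmf \<Rightarrow> real" where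
  "relative_entropy p q = (\<Sum>y\<in>UNIV. pmf p y * ln (pmf p y / pmf q y))"

lemma pmf_bind_finite:
  fixes P :: "('b::finite) pmf"
  shows "pmf (bind_pmf P K) y = (\<Sum>x\<in>UNIV. pmf P x * pmf (K x) y)"
  by (subst pmf_bind, subst integral_measure_pmf[where A=UNIV]) auto

lemma pmf_map_finite:
  fixes p :: "('c::finite) pmf"
  shows "pmf (map_pmf g p) z = (\<Sum>y | g y = z. pmf p y)"
  by (simp add: pmf_map measure_measure_pmf_finite vimage_def)

text \<open>The bound \<open>ln z \<le> z - 1\<close>, applied at \<open>z = c * v y / u y\<close>
  with \<open>c\<close> the ratio of the totals, gives a termwise estimate whose linear corrections
  cancel in the sum.\<close>

lemma log_sum_inequality:
  fixes u v :: "'c \<Rightarrow> real"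
  assumes fin: "finite T"
    and u: "\<And>y. y \<in> T \<Longrightarrow> 0 \<le> u y" and v: "\<And>y. y \<in> T \<Longrightarrow> 0 \<le> v y"
    and ac: "\<And>y. y \<in> T \<Longrightarrow> v y = 0 \<Longrightarrow> u y = 0"
  shows "sum u T * ln (sum u T / sum v T) \<le> (\<Sum>y\<in>T. u y * ln (u y / v y))"
proof (cases "sum u T = 0")
  case True
  then have "\<forall>y\<in>T. u y = 0" using sum_nonneg_eq_0_iff[OF fin, of u] u by auto
  with True show ?thesis by simp
next
  case False
  then obtain y where y: "y \<in> T" "u y \<noteq> 0" by (metis sum.neutral)
  then have "v y \<noteq> 0" using ac by blast
  then have "v y > 0" using v[OF y(1)] by simp
  then have V: "sum v T > 0" using y(1) v fin by (meson sum_pos2)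
  have U: "sum u T > 0" using False sum_nonneg[of T u] u by fastforce
  define c where "c = sum u T / sum v T"
  have c: "c > 0" using U V by (simp add: c_def)
  have "u y * ln (u y / v y) \<ge> u y * ln c + u y - c * v y" if "y \<in> T" for y
  proof (cases "u y = 0")
    case True
    then show ?thesis using c v[OF that] by simp
  next
    case False
    then have uy: "u y > 0" and vy: "v y > 0" using u v ac that by (metis order_le_less)+
    have "ln (c * v y / u y) \<le> c * v y / u y - 1"
      using c uy vy by (intro ln_le_minus_one) simp
    also have "ln (c * v y / u y) = ln c - ln (u y / v y)"
      using c uy vy by (simp add: ln_mult ln_div)
    finally have "u y * (ln c - ln (u y / v y)) \<le> u y * (c * v y / u y - 1)"
      using uy by (simp add: mult_left_mono)
    also have "\<dots> = c * v y - u y" using uy by (simp add: field_simps)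
    finally show ?thesis by (simp add: algebra_simps)
  qed
  then have "(\<Sum>y\<in>T. u y * ln c + u y - c * v y) \<le> (\<Sum>y\<in>T. u y * ln (u y / v y))"
    by (intro sum_mono)
  also have "(\<Sum>y\<in>T. u y * ln c + u y - c * v y) = sum u T * ln c + sum u T - c * sum v T"
    by (simp add: sum.distrib sum_subtractf sum_distrib_left sum_distrib_right)
  also have "\<dots> = sum u T * ln c" using V by (simp add: c_def)
  finally show ?thesis by (simp add: c_def)
qed

text \<open>Data processing: the log-sum inequality on each fibre of \<open>g\<close>, summed over
  the fibres.\<close>

lemma relative_entropy_map_le:
  fixes p q :: "('c::finite) pmf" and g :: "'c \<Rightarrow> 'd::finite"
  assumes "set_pmf p \<subseteq> set_pmf q"
  shows "relative_entropy (map_pmf g p) (map_pmf g q) \<le> relative_entropy p q"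
proof -
  have ac: "pmf q y = 0 \<Longrightarrow> pmf p y = 0" for y
    using assms by (auto simp: set_pmf_eq)
  have "relative_entropy (map_pmf g p) (map_pmf g q)
      \<le> (\<Sum>z\<in>UNIV. \<Sum>y | g y = z. pmf p y * ln (pmf p y / pmf q y))"
    unfolding relative_entropy_def pmf_map_finite
    by (intro sum_mono log_sum_inequality) (auto simp: ac)
  also have "\<dots> = relative_entropy p q"
    unfolding relative_entropy_def
    using sum.group[of UNIV UNIV g "\<lambda>y. pmf p y * ln (pmf p y / pmf q y)"] by simp
  finally show ?thesis .
qed

lemma relative_entropy_self [simp]: "relative_entropy p p = 0"
  unfolding relative_entropy_def by (intro sum.neutral) (metis div_self ln_one mult_eq_0_iff)

text \<open>Gibbs' inequality as data processing under the map to one point, where both laws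
  coincide.\<close>

lemma relative_entropy_nonneg:
  assumes "set_pmf p \<subseteq> set_pmf q"
  shows "0 \<le> relative_entropy p q"
proof -
  have "map_pmf (\<lambda>_. ()) p = map_pmf (\<lambda>_. ()) q" by (simp add: map_pmf_const)
  then show ?thesis using relative_entropy_map_le[OF assms, of "\<lambda>_. ()"] by simp
qed

text \<open>If \<open>Q\<close> is the output law of \<open>K\<close>, this is the mutual
  information in nats. Leaving \<open>Q\<close> free allows output laws of different channels to be
  compared.\<close>

definition mean_relative_entropy ::
  "('b::finite) pmf \<Rightarrow> ('b \<Rightarrow> ('c::finite) pmf) \<Rightarrow> 'c pmf \<Rightarrow> real" where
  "mean_relative_entropy P K Q = (\<Sum>x\<in>UNIV. pmf P x * relative_entropy (K x) Q)"

text \<open>Split \<open>ln (K / Q)\<close> as \<open>ln (K / B) + ln (B / Q)\<close>, where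
  \<open>B\<close> is the output law; averaging the second part over the inputs turns
  \<open>K\<close> into \<open>B\<close>.\<close>

lemma mean_relative_entropy_compensation:
  assumes "set_pmf (bind_pmf P K) \<subseteq> set_pmf Q"
  shows "mean_relative_entropy P K Q =
    mean_relative_entropy P K (bind_pmf P K) + relative_entropy (bind_pmf P K) Q"
proof -
  let ?B = "bind_pmf P K"
  have *: "pmf P x * (pmf (K x) y * ln (pmf (K x) y / pmf Q y)) =
      pmf P x * (pmf (K x) y * ln (pmf (K x) y / pmf ?B y)) +
      pmf P x * pmf (K x) y * ln (pmf ?B y / pmf Q y)" for x y
  proof (cases "pmf P x = 0 \<or> pmf (K x) y = 0")
    case False
    then have "x \<in> set_pmf P" "y \<in> set_pmf (K x)" by (auto simp: set_pmf_eq)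
    then have "y \<in> set_pmf ?B" "y \<in> set_pmf Q" using assms by auto
    then have "pmf ?B y > 0" "pmf Q y > 0" "pmf (K x) y > 0"
      using \<open>y \<in> set_pmf (K x)\<close> by (auto simp: pmf_positive)
    then show ?thesis by (simp add: ln_div algebra_simps)
  qed auto
  have "relative_entropy ?B Q =
      (\<Sum>y\<in>UNIV. \<Sum>x\<in>UNIV. pmf P x * pmf (K x) y * ln (pmf ?B y / pmf Q y))"
    unfolding relative_entropy_def
    by (intro sum.cong refl) (simp add: sum_distrib_right[symmetric] pmf_bind_finite[symmetric])
  also have "\<dots> = (\<Sum>x\<in>UNIV. \<Sum>y\<in>UNIV. pmf P x * pmf (K x) y * ln (pmf ?B y / pmf Q y))"
    by (rule sum.swap)
  finally show ?thesis
    unfolding mean_relative_entropy_def relative_entropy_def[of "K _"]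
    by (simp add: sum_distrib_left * sum.distrib)
qed

text \<open>Optimality of the output law; both the lower and the upper bound on the rate rest on
  it.\<close>

lemma mean_relative_entropy_output_le:
  assumes "set_pmf (bind_pmf P K) \<subseteq> set_pmf Q"
  shows "mean_relative_entropy P K (bind_pmf P K) \<le> mean_relative_entropy P K Q"
  using mean_relative_entropy_compensation[OF assms] relative_entropy_nonneg[OF assms] by simp

text \<open>The weight matters: at an input of probability 0 the support of \<open>K x\<close> may
  leave that of the output law.\<close>

lemma relative_entropy_output_nonneg:
  "0 \<le> pmf P x * relative_entropy (K x) (bind_pmf P K)"
proof (cases "pmf P x = 0")
  case False
  then have "set_pmf (K x) \<subseteq> set_pmf (bind_pmf P K)" by (auto simp: set_pmf_eq[of P])
  then show ?thesis by (simp add: relative_entropy_nonneg)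
qed simp

section \<open>Mutual information of a channel\<close>

lemma pmf_channel_joint:
  fixes P :: "('b::finite) pmf"
  shows "pmf (channel_joint P K) (x, y) = pmf P x * pmf (K x) y"
proof -
  have "pmf (map_pmf (Pair x') (K x')) (x, y) = (if x' = x then pmf (K x) y else 0)" for x'
  proof -
    have "Pair x' -` {(x, y)} = (if x' = x then {y} else {})" by auto
    then show ?thesis by (simp add: pmf_map measure_pmf_single)
  qed
  then show ?thesis
    unfolding channel_joint_def pmf_bind_finite by (subst sum.remove[of _ x]) auto
qed

lemma map_fst_channel_joint: "map_pmf fst (channel_joint P K) = P"
  by (simp add: channel_joint_def map_bind_pmf map_pmf_comp map_pmf_const bind_return_pmf')

lemma map_snd_channel_joint: "map_pmf snd (channel_joint P K) = bind_pmf P K"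
  by (simp add: channel_joint_def map_bind_pmf map_pmf_comp)

lemma distributed_measure_pmf:
  "distributed (measure_pmf J) (count_space UNIV) X (\<lambda>x. ennreal (pmf (map_pmf X J) x))"
  unfolding distributed_def
proof (intro conjI)
  have "distr (measure_pmf J) (count_space UNIV) X = measure_pmf (map_pmf X J)"
    by (rule map_pmf_rep_eq[symmetric])
  also have "\<dots> = density (count_space UNIV) (pmf (map_pmf X J))"
    by (rule measure_pmf_eq_density)
  finally show "distr (measure_pmf J) (count_space UNIV) X =
    density (count_space UNIV) (pmf (map_pmf X J))" .
qed auto

text \<open>The joint density is \<open>pmf P x * pmf (K x) y\<close>, so the input probability
  cancels against the product of the marginals.\<close>

lemma channel_information_eq:
  fixes P :: "('b::finite) pmf" and K :: "'b \<Rightarrow> ('c::finite) pmf"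
  assumes "1 < b"
  shows "channel_information b P K = mean_relative_entropy P K (bind_pmf P K) / ln b"
proof -
  let ?J = "channel_joint P K" and ?B = "bind_pmf P K"
  interpret information_space "measure_pmf ?J" b
    by unfold_locales (use assms in auto)
  have pmf_joint: "pmf ?J z = pmf P (fst z) * pmf (K (fst z)) (snd z)" for z
    using pmf_channel_joint[of P K "fst z" "snd z"] by simp
  have prod: "count_space UNIV \<Otimes>\<^sub>M count_space UNIV = (count_space UNIV :: ('b \<times> 'c) measure)"
    by (subst pair_measure_count_space) auto
  have sf: "sigma_finite_measure (count_space (UNIV :: 'b set))"
    "sigma_finite_measure (count_space (UNIV :: 'c set))"
    by (auto intro: sigma_finite_measure_count_space_finite)
  have dist: "distributed (measure_pmf ?J) (count_space UNIV) fst (\<lambda>x. ennreal (pmf P x))"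
    "distributed (measure_pmf ?J) (count_space UNIV) snd (\<lambda>y. ennreal (pmf ?B y))"
    "distributed (measure_pmf ?J) (count_space UNIV \<Otimes>\<^sub>M count_space UNIV)
       (\<lambda>z. (fst z, snd z)) (\<lambda>z. ennreal (pmf ?J z))"
    using distributed_measure_pmf[of ?J fst] distributed_measure_pmf[of ?J snd]
      distributed_measure_pmf[of ?J "\<lambda>z. z"]
    by (simp_all add: prod map_fst_channel_joint map_snd_channel_joint map_pmf_ident)
  have "channel_information b P K =
      (\<integral>z. pmf ?J z * log b (pmf ?J z / (pmf P (fst z) * pmf ?B (snd z)))
        \<partial>(count_space UNIV \<Otimes>\<^sub>M count_space UNIV))"
    unfolding channel_information_def
    by (rule mutual_information_distr[OF sf dist(1) _ dist(2) _ dist(3)]) auto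
  also have "\<dots> = (\<Sum>(x, y)\<in>UNIV. pmf P x * pmf (K x) y * log b (pmf P x * pmf (K x) y / (pmf P x * pmf ?B y)))"
    unfolding prod
    by (subst lebesgue_integral_count_space_finite)
      (simp_all add: split_beta pmf_joint del: mult_divide_mult_cancel_left_if)
  \<comment> \<open>The cancellation is harmless at \<open>pmf P x = 0\<close>, since both summands
    then vanish.\<close>
  also have "\<dots> = (\<Sum>(x, y)\<in>UNIV. pmf P x * (pmf (K x) y * ln (pmf (K x) y / pmf ?B y)) / ln b)"
    by (intro sum.cong refl) (auto simp: log_def)
  also have "\<dots> = mean_relative_entropy P K ?B / ln b"
    unfolding mean_relative_entropy_def relative_entropy_def
    by (simp add: sum.cartesian_product UNIV_Times_UNIV[symmetric] sum_distrib_left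
        sum_divide_distrib split_beta del: UNIV_Times_UNIV)
  finally show ?thesis .
qed

lemma channel_information_nonneg:
  assumes "1 < b"
  shows "0 \<le> channel_information b P K"
  unfolding channel_information_eq[OF assms] mean_relative_entropy_def using assms
  by (intro divide_nonneg_pos sum_nonneg relative_entropy_output_nonneg) auto

lemma channel_information_const:
  assumes "1 < b"
  shows "channel_information b P (\<lambda>_. q) = 0"
  by (simp add: channel_information_eq[OF assms] mean_relative_entropy_def bind_pmf_const)

text \<open>Applying \<open>g\<close> to the channel applies \<open>g\<close> to its output law, so
  data processing for relative entropy works input by input.\<close>

lemma channel_information_map_le:
  fixes K :: "'b::finite \<Rightarrow> ('c::finite) pmf" and g :: "'c \<Rightarrow> 'd::finite"
  assumes "1 < b"
  shows "channel_information b P (\<lambda>x. map_pmf g (K x)) \<le> channel_information b P K"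
proof -
  have "pmf P x * relative_entropy (map_pmf g (K x)) (map_pmf g (bind_pmf P K))
      \<le> pmf P x * relative_entropy (K x) (bind_pmf P K)" for x
  proof (cases "pmf P x = 0")
    case False
    then have "set_pmf (K x) \<subseteq> set_pmf (bind_pmf P K)" by (auto simp: set_pmf_eq[of P])
    then show ?thesis by (simp add: relative_entropy_map_le mult_left_mono)
  qed simp
  then show ?thesis
    unfolding channel_information_eq[OF assms] mean_relative_entropy_def
      map_bind_pmf[symmetric]
    using assms by (intro divide_right_mono sum_mono) auto
qed

section \<open>Existence of an optimal channel\<close>

text \<open>The endpoint 0 is essential, as channels with vanishing entries belong to the compact
  set minimised over.\<close>

lemma continuous_on_mult_ln: "continuous_on {0..} (\<lambda>t::real. t * ln t)"
proof (rule continuous_on_eq_continuous_within[THEN iffD2], rule ballI)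
  fix t :: real assume "t \<in> {0..}"
  show "continuous (at t within {0..}) (\<lambda>t. t * ln t)"
  proof (cases "t = 0")
    case True
    have "((\<lambda>t::real. t * ln t) \<longlongrightarrow> 0) (at_right 0)" by real_asymp
    then have "((\<lambda>t::real. t * ln t) \<longlongrightarrow> 0) (at 0 within {0..})"
      by (simp add: at_within_Ici_at_right)
    then show ?thesis by (simp add: True continuous_within)
  next
    case False
    then show ?thesis by (intro continuous_intros) auto
  qed
qed

text \<open>Output entropy minus conditional entropy: written with \<open>t * ln t\<close>, the
  information has no quotient left and is visibly continuous.\<close>

lemma mean_relative_entropy_output_eq:
  "mean_relative_entropy P K (bind_pmf P K) =
    (\<Sum>x\<in>UNIV. pmf P x * (\<Sum>y\<in>UNIV. pmf (K x) y * ln (pmf (K x) y))) -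
    (\<Sum>y\<in>UNIV. pmf (bind_pmf P K) y * ln (pmf (bind_pmf P K) y))"
proof -
  let ?B = "bind_pmf P K"
  have *: "pmf P x * (pmf (K x) y * ln (pmf (K x) y / pmf ?B y)) =
      pmf P x * (pmf (K x) y * ln (pmf (K x) y)) - pmf P x * pmf (K x) y * ln (pmf ?B y)" for x y
  proof (cases "pmf P x = 0 \<or> pmf (K x) y = 0")
    case False
    then have "x \<in> set_pmf P" "y \<in> set_pmf (K x)" by (auto simp: set_pmf_eq)
    then have "pmf ?B y > 0" "pmf (K x) y > 0" by (auto simp: pmf_positive_iff)
    then show ?thesis by (simp add: ln_div algebra_simps)
  qed auto
  have "(\<Sum>y\<in>UNIV. pmf ?B y * ln (pmf ?B y)) =
      (\<Sum>y\<in>UNIV. \<Sum>x\<in>UNIV. pmf P x * pmf (K x) y * ln (pmf ?B y))"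
    by (intro sum.cong refl) (simp add: sum_distrib_right[symmetric] pmf_bind_finite[symmetric])
  also have "\<dots> = (\<Sum>x\<in>UNIV. \<Sum>y\<in>UNIV. pmf P x * pmf (K x) y * ln (pmf ?B y))"
    by (rule sum.swap)
  finally show ?thesis
    unfolding mean_relative_entropy_def relative_entropy_def
    by (simp add: sum_distrib_left * sum_subtractf)
qed

text \<open>Channels with prescribed supports form a compact set of matrices, on which the
  information is continuous.\<close>

lemma channel_information_attains_min:
  fixes P :: "('b::finite) pmf" and G :: "'b \<Rightarrow> ('c::finite) set"
  assumes b: "1 < b" and G: "\<And>x. G x \<noteq> {}"
  shows "\<exists>K. (\<forall>x. set_pmf (K x) \<subseteq> G x) \<and>
    (\<forall>K'. (\<forall>x. set_pmf (K' x) \<subseteq> G x) \<longrightarrow>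
      channel_information b P K \<le> channel_information b P K')"
proof -
  \<comment> \<open>Stochastic matrices with zeros outside \<open>G\<close>; the box gives both
    boundedness and nonnegativity.\<close>
  define V :: "(real ^ ('b \<times> 'c)) set" where
    "V = cbox 0 1 \<inter> {v. \<forall>x. (\<Sum>y\<in>UNIV. v $ (x, y)) = 1} \<inter> {v. \<forall>x y. y \<notin> G x \<longrightarrow> v $ (x, y) = 0}"
  define vec where "vec K = (\<chi> z. pmf (K (fst z)) (snd z))" for K :: "'b \<Rightarrow> 'c pmf"
  define h where "h t = t * ln t" for t :: real
  define F where "F v = (\<Sum>x\<in>UNIV. pmf P x * (\<Sum>y\<in>UNIV. h (v $ (x, y)))) -
    (\<Sum>y\<in>UNIV. h (\<Sum>x\<in>UNIV. pmf P x * v $ (x, y)))" for v :: "real ^ ('b \<times> 'c)"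
  have info: "channel_information b P K = F (vec K) / ln b" for K
    unfolding channel_information_eq[OF b] mean_relative_entropy_output_eq F_def vec_def h_def
    by (simp add: pmf_bind_finite)
  have vec_V: "vec K \<in> V" if "\<And>x. set_pmf (K x) \<subseteq> G x" for K
  proof -
    have "pmf (K x) y = 0" if "y \<notin> G x" for x y
      using that \<open>\<And>x. set_pmf (K x) \<subseteq> G x\<close>[of x] by (auto simp: set_pmf_eq)
    then show ?thesis
      by (auto simp: V_def vec_def mem_box_cart pmf_le_1 sum_pmf_eq_1)
  qed
  \<comment> \<open>Every point of \<open>V\<close> comes from an admissible channel, so a minimiser
    in \<open>V\<close> yields an optimal channel.\<close>
  have vec_surj: "\<exists>K. (\<forall>x. set_pmf (K x) \<subseteq> G x) \<and> vec K = v" if "v \<in> V" for v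
  proof -
    define K where "K x = embed_pmf (\<lambda>y. v $ (x, y))" for x
    have "pmf (K x) y = v $ (x, y)" for x y
      unfolding K_def
    proof (rule pmf_embed_pmf)
      show nn: "0 \<le> v $ (x, y)" for y using that by (auto simp: V_def mem_box_cart)
      have "(\<Sum>y\<in>UNIV. ennreal (v $ (x, y))) = ennreal (\<Sum>y\<in>UNIV. v $ (x, y))"
        using nn by (intro sum_ennreal) auto
      then show "(\<integral>\<^sup>+ y. ennreal (v $ (x, y)) \<partial>count_space UNIV) = 1"
        using that by (simp add: nn_integral_count_space_finite V_def)
    qed
    then have "vec K = v" "set_pmf (K x) \<subseteq> G x" for x
      using that by (auto simp: vec_def vec_eq_iff V_def set_pmf_eq)
    then show ?thesis by blast
  qed
  have "compact V"
    unfolding V_def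
    by (intro compact_Int_closed compact_cbox closed_Collect_all closed_Collect_imp
        closed_Collect_eq continuous_intros) auto
  moreover have "V \<noteq> {}"
  proof -
    have "set_pmf (return_pmf (SOME y. y \<in> G x)) \<subseteq> G x" for x
      using G[of x] by (simp add: some_in_eq)
    from vec_V[OF this] show ?thesis by blast
  qed
  moreover have "continuous_on V F"
  proof -
    have h: "continuous_on V (\<lambda>v. h (f v))" if "continuous_on V f" "\<And>v. v \<in> V \<Longrightarrow> f v \<ge> 0"
      for f :: "real ^ ('b \<times> 'c) \<Rightarrow> real"
      unfolding h_def
      by (rule continuous_on_compose2[OF continuous_on_mult_ln that(1)]) (use that(2) in auto)
    have nn: "v $ z \<ge> 0" if "v \<in> V" for v z
      using that by (cases z) (auto simp: V_def mem_box_cart)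
    show ?thesis
      unfolding F_def by (intro continuous_intros h sum_nonneg mult_nonneg_nonneg nn) auto
  qed
  ultimately obtain v where v: "v \<in> V" "\<And>w. w \<in> V \<Longrightarrow> F v \<le> F w"
    using continuous_attains_inf by metis
  obtain K where K: "\<And>x. set_pmf (K x) \<subseteq> G x" "vec K = v"
    using vec_surj[OF v(1)] by blast
  have "channel_information b P K \<le> channel_information b P K'"
    if "\<forall>x. set_pmf (K' x) \<subseteq> G x" for K'
  proof -
    have "F (vec K) \<le> F (vec K')" using v(2) vec_V that K(2) by simp
    then show ?thesis using b by (simp add: info divide_right_mono)
  qed
  then show ?thesis using K(1) by blast
qed

text \<open>Over the reals, \<open>LEAST\<close> can be evaluated only once a minimiser is
  exhibited.\<close>

lemma min_information_eq:
  assumes "K \<in> F" "\<And>K'. K' \<in> F \<Longrightarrow> channel_information b P K \<le> channel_information b P K'"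
  shows "min_information b P F = channel_information b P K"
  unfolding min_information_def by (rule Least_equality) (use assms in auto)

section \<open>Conditioning the source on an event\<close>

text \<open>On \<open>A\<close> the conditional law is \<open>P\<close> divided by the probability
  of \<open>A\<close>, and this factor cancels.\<close>

lemma mean_relative_entropy_cond_pmf:
  assumes "set_pmf P \<inter> A \<noteq> {}"
  shows "measure_pmf.prob P A * mean_relative_entropy (cond_pmf P A) K Q =
    (\<Sum>x\<in>A. pmf P x * relative_entropy (K x) Q)"
proof -
  have "measure_pmf.prob P A \<noteq> 0"
    using assms by (simp add: measure_measure_pmf_not_zero)
  then have "measure_pmf.prob P A * mean_relative_entropy (cond_pmf P A) K Q =
      (\<Sum>x\<in>UNIV. if x \<in> A then pmf P x * relative_entropy (K x) Q else 0)"
    unfolding mean_relative_entropy_def sum_distrib_left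
    by (intro sum.cong refl) (simp add: pmf_cond[OF assms])
  then show ?thesis by (simp add: sum.If_cases)
qed

text \<open>For the conditioned source the output law of the whole source is just one competitor, so
  using it can only increase the mean divergence. The inputs outside \<open>A\<close> then add
  nonnegative terms.\<close>

lemma channel_information_cond_pmf_le:
  assumes b: "1 < b" and ne: "set_pmf P \<inter> A \<noteq> {}"
  shows "measure_pmf.prob P A * channel_information b (cond_pmf P A) K \<le> channel_information b P K"
proof -
  let ?\<pi> = "cond_pmf P A" and ?B = "bind_pmf P K"
  have "mean_relative_entropy ?\<pi> K (bind_pmf ?\<pi> K) \<le> mean_relative_entropy ?\<pi> K ?B"
    by (rule mean_relative_entropy_output_le) (use ne in auto)
  then have "measure_pmf.prob P A * mean_relative_entropy ?\<pi> K (bind_pmf ?\<pi> K)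
      \<le> (\<Sum>x\<in>A. pmf P x * relative_entropy (K x) ?B)"
    unfolding mean_relative_entropy_cond_pmf[OF ne, symmetric] by (simp add: mult_left_mono)
  also have "\<dots> \<le> mean_relative_entropy P K ?B"
    unfolding mean_relative_entropy_def
    by (intro sum_mono2 relative_entropy_output_nonneg) auto
  finally show ?thesis
    using b by (simp add: channel_information_eq divide_le_cancel)
qed

text \<open>Outside the event the channel emits the output law it has on the event, so it
  conveys no information there.\<close>

lemma channel_information_extend_le:
  assumes b: "1 < b" and ne: "set_pmf P \<inter> A \<noteq> {}"
  shows "channel_information b P (\<lambda>x. if x \<in> A then K x else bind_pmf (cond_pmf P A) K)
    \<le> measure_pmf.prob P A * channel_information b (cond_pmf P A) K"
proof -
  let ?Q = "bind_pmf (cond_pmf P A) K"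
  let ?L = "\<lambda>x. if x \<in> A then K x else ?Q"
  have "mean_relative_entropy P ?L (bind_pmf P ?L) \<le> mean_relative_entropy P ?L ?Q"
    by (rule mean_relative_entropy_output_le) (use ne in \<open>auto simp: set_cond_pmf[OF ne] split: if_splits\<close>)
  \<comment> \<open>Outside \<open>A\<close> the channel emits \<open>?Q\<close> itself, at relative
    entropy 0 from \<open>?Q\<close>.\<close>
  also have "\<dots> = (\<Sum>x\<in>UNIV. if x \<in> A then pmf P x * relative_entropy (K x) ?Q else 0)"
    unfolding mean_relative_entropy_def by (intro sum.cong) auto
  also have "\<dots> = measure_pmf.prob P A * mean_relative_entropy (cond_pmf P A) K ?Q"
    by (simp add: mean_relative_entropy_cond_pmf[OF ne] sum.If_cases)
  finally show ?thesis
    using b by (simp add: channel_information_eq divide_le_cancel)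
qed

section \<open>Zero distortion and the core\<close>

text \<open>When \<open>s\<close> is deleted it is derivable from the rest of the current set, which
  is part of the knowledge base; monotonicity does the rest.\<close>

lemma derivable_if_not_in_Atom:
  assumes mono: "\<And>\<Gamma> \<Gamma>'. \<Gamma> \<subseteq> \<Gamma>' \<Longrightarrow> Cn \<Gamma> \<subseteq> Cn \<Gamma>'"
    and "s \<in> set ss" "s \<notin> Atom Cn ss"
  shows "s \<in> Cn (set ss - {s})"
proof -
  \<comment> \<open>Generalised to a scan of any list from any current set \<open>B\<close> inside a
    fixed \<open>S\<close>, so that the induction can pass to the shrunken set.\<close>
  have "s \<in> Cn (S - {s})"
    if "B \<subseteq> S" "s \<in> B" "s \<notin> fold (\<lambda>s B. if s \<in> Cn (B - {s}) then B - {s} else B) xs B" for xs B S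
    using that
  proof (induction xs arbitrary: B)
    case (Cons x xs)
    show ?case
    proof (cases "x \<in> Cn (B - {x}) \<and> s = x")
      case True
      then show ?thesis using mono[of "B - {x}" "S - {x}"] Cons.prems by auto
    next
      case False
      then show ?thesis
        using Cons.IH[of B] Cons.IH[of "B - {x}"] Cons.prems by (auto split: if_splits)
    qed
  qed simp
  from this[of "set ss" "set ss" ss] show ?thesis using assms(2,3) by (simp add: Atom_def)
qed

lemma closure_distortion_nonneg:
  fixes Cn :: "('a::finite) set \<Rightarrow> 'a set"
  shows "0 \<le> closure_distortion Cn S s s'"
proof -
  have "card (X \<inter> Y) \<le> card (X \<union> Y)" for X Y :: "'a set" by (rule card_mono) auto
  then have "real (card (X \<inter> Y)) / real (card (X \<union> Y)) \<le> 1" for X Y :: "'a set"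
    by (simp add: divide_le_eq)
  then show ?thesis by (simp add: closure_distortion_def Let_def)
qed

text \<open>A Jaccard distance on finite sets vanishes exactly on equal sets; the convention for
  \<open>0/0\<close> covers two empty closures.\<close>

lemma closure_distortion_eq_0_iff:
  fixes Cn :: "('a::finite) set \<Rightarrow> 'a set"
  shows "closure_distortion Cn S s s' = 0 \<longleftrightarrow> Cn (insert s' (S - {s})) = Cn S"
proof -
  have *: "real (card (X \<inter> Y)) / real (card (X \<union> Y)) = 1 \<longleftrightarrow> X = Y" if "X \<union> Y \<noteq> {}" for X Y :: "'a set"
  proof -
    have "card (X \<union> Y) \<noteq> 0" using that by simp
    then have "real (card (X \<inter> Y)) / real (card (X \<union> Y)) = 1 \<longleftrightarrow> card (X \<inter> Y) = card (X \<union> Y)"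
      by (auto simp: divide_eq_1_iff)
    also have "\<dots> \<longleftrightarrow> X \<inter> Y = X \<union> Y"
      using card_subset_eq[of "X \<union> Y" "X \<inter> Y"] by auto
    finally show ?thesis by blast
  qed
  show ?thesis
    using *[of "Cn S" "Cn (insert s' (S - {s}))"] by (auto simp: closure_distortion_def Let_def)
qed

text \<open>By reflexivity \<open>t\<close> lies in the modified closure, which equals
  \<open>Cn S\<close>. Thus every letter acceptable for a core statement is a candidate for the
  redundant ones.\<close>

lemma zero_distortion_set_subset:
  fixes Cn :: "('a::finite) set \<Rightarrow> 'a set"
  assumes refl: "\<And>\<Gamma>. \<Gamma> \<subseteq> Cn \<Gamma>"
  shows "zero_distortion_set Cn S S' s \<subseteq> S' \<inter> Cn S"
proof
  fix t assume "t \<in> zero_distortion_set Cn S S' s"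
  then have "t \<in> S'" "Cn (insert t (S - {s})) = Cn S"
    by (simp_all add: zero_distortion_set_def closure_distortion_eq_0_iff)
  then show "t \<in> S' \<inter> Cn S" using refl[of "insert t (S - {s})"] by auto
qed

text \<open>Deleting \<open>s\<close> keeps the closure, and so does adding any \<open>t\<close> in
  \<open>Cn S\<close>: the modified closure is squeezed between \<open>Cn (S - {s})\<close> and
  \<open>Cn S\<close>, which agree.\<close>

lemma zero_distortion_set_redundant:
  fixes Cn :: "('a::finite) set \<Rightarrow> 'a set"
  assumes refl: "\<And>\<Gamma>. \<Gamma> \<subseteq> Cn \<Gamma>"
    and mono: "\<And>\<Gamma> \<Gamma>'. \<Gamma> \<subseteq> \<Gamma>' \<Longrightarrow> Cn \<Gamma> \<subseteq> Cn \<Gamma>'"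
    and idem: "\<And>\<Gamma>. Cn (Cn \<Gamma>) = Cn \<Gamma>"
    and s: "s \<in> Cn (S - {s})"
  shows "zero_distortion_set Cn S S' s = S' \<inter> Cn S"
proof
  show "zero_distortion_set Cn S S' s \<subseteq> S' \<inter> Cn S"
    by (rule zero_distortion_set_subset[OF refl])
  have "S \<subseteq> Cn (S - {s})" using refl[of "S - {s}"] s by blast
  then have "Cn S \<subseteq> Cn (S - {s})" using mono[of S "Cn (S - {s})"] by (simp add: idem)
  moreover have "Cn (S - {s}) \<subseteq> Cn (insert t (S - {s}))" for t by (rule mono) blast
  moreover have "Cn (insert t (S - {s})) \<subseteq> Cn S" if "t \<in> Cn S" for t
    using mono[of "insert t (S - {s})" "Cn S"] idem[of S] refl[of S] that by auto
  ultimately have "Cn (insert t (S - {s})) = Cn S" if "t \<in> Cn S" for t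
    using that by (meson subset_antisym subset_trans)
  then show "S' \<inter> Cn S \<subseteq> zero_distortion_set Cn S S' s"
    by (auto simp: zero_distortion_set_def closure_distortion_eq_0_iff)
qed

section \<open>Admissible channels as support conditions\<close>

lemma test_channels_zero_iff:
  fixes P :: "('a::finite) pmf"
  assumes nonneg: "\<And>s s'. 0 \<le> d s s'"
  shows "K \<in> test_channels S S' d P 0 \<longleftrightarrow>
    (\<forall>s\<in>S. set_pmf (K s) \<subseteq> S') \<and> (\<forall>s\<in>set_pmf P. \<forall>s'\<in>set_pmf (K s). d s s' = 0)"
proof -
  let ?J = "measure_pmf (channel_joint P K)" and ?d = "\<lambda>(s, s'). d s s'"
  have "(\<integral>z. ?d z \<partial>?J) \<ge> 0"
    by (intro Bochner_Integration.integral_nonneg) (auto simp: nonneg)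
  \<comment> \<open>A nonnegative distortion has mean at most 0 only if it vanishes almost surely,
    so the average constraint becomes one on supports.\<close>
  then have "(\<integral>z. ?d z \<partial>?J) \<le> 0 \<longleftrightarrow> (\<integral>z. ?d z \<partial>?J) = 0" by linarith
  also have "\<dots> \<longleftrightarrow> (AE z in ?J. ?d z = 0)"
    by (intro integral_nonneg_eq_0_iff_AE) (auto simp: nonneg integrable_measure_pmf_finite)
  also have "\<dots> \<longleftrightarrow> (\<forall>s\<in>set_pmf P. \<forall>s'\<in>set_pmf (K s). d s s' = 0)"
    by (auto simp: AE_measure_pmf_iff channel_joint_def)
  finally show ?thesis by (simp add: test_channels_def)
qed

lemma subset_channels_iff:
  "K \<in> subset_channels A \<Gamma> \<pi> \<longleftrightarrow>
    (\<forall>a\<in>A. set_pmf (K a) \<subseteq> Pow A) \<and> (\<forall>a\<in>set_pmf \<pi>. \<forall>W\<in>set_pmf (K a). a \<in> W \<and> W \<in> \<Gamma>)"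
  by (auto simp: subset_channels_def AE_measure_pmf_iff channel_joint_def)

lemma subset_channels_attain_min:
  fixes \<pi> :: "('a::finite) pmf"
  assumes b: "1 < b" and \<pi>: "set_pmf \<pi> \<subseteq> A"
    and \<Gamma>: "\<Gamma> \<subseteq> Pow A" "\<And>a. a \<in> A \<Longrightarrow> {a} \<in> \<Gamma>"
  shows "\<exists>K\<in>subset_channels A \<Gamma> \<pi>. \<forall>K'\<in>subset_channels A \<Gamma> \<pi>.
    channel_information b \<pi> K \<le> channel_information b \<pi> K'"
proof -
  \<comment> \<open>Admissibility is recast letter by letter: inputs of positive probability need
    hyperedges containing them, other core inputs only subsets of \<open>A\<close>, and inputs
    outside \<open>A\<close> are free. Singletons keep the first kind nonempty.\<close>
  define G where
    "G a = (if a \<in> set_pmf \<pi> then {W \<in> \<Gamma>. a \<in> W} else if a \<in> A then Pow A else UNIV)" for a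
  have "G a \<noteq> {}" for a using \<Gamma>(2)[of a] \<pi> by (auto simp: G_def)
  note min = channel_information_attains_min[OF b this]
  have G_iff: "K' \<in> subset_channels A \<Gamma> \<pi> \<longleftrightarrow> (\<forall>a. set_pmf (K' a) \<subseteq> G a)" for K'
  proof
    assume K': "K' \<in> subset_channels A \<Gamma> \<pi>"
    show "\<forall>a. set_pmf (K' a) \<subseteq> G a"
      using K' unfolding subset_channels_iff G_def by auto
  next
    assume *: "\<forall>a. set_pmf (K' a) \<subseteq> G a"
    have "G a \<subseteq> Pow A" if "a \<in> A" for a
      using that \<Gamma>(1) by (auto simp: G_def)
    moreover have "G a = {W \<in> \<Gamma>. a \<in> W}" if "a \<in> set_pmf \<pi>" for a
      using that by (simp add: G_def)
    ultimately show "K' \<in> subset_channels A \<Gamma> \<pi>"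
      using * unfolding subset_channels_iff by blast
  qed
  show ?thesis using min[where P=\<pi>] by (simp add: Bex_def Ball_def G_iff)
qed

lemma rate_distortion_eq:
  assumes "K \<in> test_channels S S' d P D"
    and "\<And>K'. K' \<in> test_channels S S' d P D \<Longrightarrow>
      channel_information b P K \<le> channel_information b P K'"
  shows "rate_distortion b S S' d P D = ereal (channel_information b P K)"
  using assms min_information_eq[OF assms] by (auto simp: rate_distortion_def)

theorem mainTheorem2:
  fixes Cn :: "('a::finite) set \<Rightarrow> 'a set"
    and ss :: "'a list" and S S' A :: "'a set"
    and P :: "'a pmf" and b PA :: real and R :: "'a \<Rightarrow> 'a set"
  assumes Cn_refl: "\<And>\<Gamma>. \<Gamma> \<subseteq> Cn \<Gamma>"
    and Cn_mono: "\<And>\<Gamma> \<Gamma>'. \<Gamma> \<subseteq> \<Gamma>' \<Longrightarrow> Cn \<Gamma> \<subseteq> Cn \<Gamma>'"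
    and Cn_idem: "\<And>\<Gamma>. Cn (Cn \<Gamma>) = Cn \<Gamma>"
    and order: "distinct ss" "S = set ss"
    and source: "set_pmf P \<subseteq> S"
    and alphabet: "S' \<noteq> {}"
    and base: "1 < b"
  defines "A \<equiv> Atom Cn ss"
    and "PA \<equiv> measure_pmf.prob P A"
    and "R \<equiv> zero_distortion_set Cn S S'"
  assumes core: "A \<noteq> {}"
    and cases: "(PA = 0 \<and> S' \<inter> Cn S \<noteq> {}) \<or> (PA > 0 \<and> (\<forall>a\<in>A. R a \<noteq> {}))"
  shows "rate_distortion b S S' (closure_distortion Cn S) P 0 =
    ereal (if PA = 0 then 0
           else PA * hypergraph_entropy b A (zero_distortion_hypergraph A R) (cond_pmf P A))"
proof -
  let ?d = "closure_distortion Cn S"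
  let ?T = "test_channels S S' ?d P 0"
  have T: "K \<in> ?T \<longleftrightarrow> (\<forall>s\<in>S. set_pmf (K s) \<subseteq> S') \<and> (\<forall>s\<in>set_pmf P. set_pmf (K s) \<subseteq> R s)" for K
    using source by (auto simp: test_channels_zero_iff closure_distortion_nonneg R_def
        zero_distortion_set_def)
  have R_sub: "R s \<subseteq> S' \<inter> Cn S" for s
    unfolding R_def by (rule zero_distortion_set_subset[OF Cn_refl])
  have R_red: "R s = S' \<inter> Cn S" if "s \<in> S" "s \<notin> A" for s
    unfolding R_def
    by (rule zero_distortion_set_redundant[OF Cn_refl Cn_mono Cn_idem])
      (use that derivable_if_not_in_Atom[OF Cn_mono] in \<open>auto simp: A_def order\<close>)
  show ?thesis
  proof (cases "PA = 0")
    case True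
    then obtain t where t: "t \<in> S'" "t \<in> Cn S" using cases by auto
    have "set_pmf P \<inter> A = {}"
      using True by (simp add: PA_def measure_pmf_zero_iff)
    \<comment> \<open>The source charges only redundant statements, and each of them tolerates
      \<open>t\<close>.\<close>
    then have "(\<lambda>_. return_pmf t) \<in> ?T"
      using t source R_red by (auto simp: T)
    then have "rate_distortion b S S' ?d P 0 = ereal (channel_information b P (\<lambda>_. return_pmf t))"
      by (rule rate_distortion_eq)
        (simp add: channel_information_const[OF base] channel_information_nonneg[OF base])
    then show ?thesis using True by (simp add: channel_information_const[OF base])
  next
    case False
    then have PA: "PA > 0" and R_ne: "\<And>a. a \<in> A \<Longrightarrow> R a \<noteq> {}" using cases by auto
    have ne: "set_pmf P \<inter> A \<noteq> {}"
      using False by (simp add: PA_def measure_pmf_zero_iff)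
    define \<pi> where "\<pi> = cond_pmf P A"
    define \<Gamma> where "\<Gamma> = zero_distortion_hypergraph A R"
    have set_\<pi>: "set_pmf \<pi> = set_pmf P \<inter> A" by (simp add: \<pi>_def ne)
    have \<pi>_A: "set_pmf \<pi> \<subseteq> A" and \<Gamma>_A: "\<Gamma> \<subseteq> Pow A"
      by (auto simp: set_\<pi> \<Gamma>_def zero_distortion_hypergraph_def)
    have "{a} \<in> \<Gamma>" if "a \<in> A" for a
      using R_ne[OF that] that by (simp add: \<Gamma>_def zero_distortion_hypergraph_def)
    then obtain K0 where K0: "K0 \<in> subset_channels A \<Gamma> \<pi>" and K0_min:
      "\<And>K. K \<in> subset_channels A \<Gamma> \<pi> \<Longrightarrow> channel_information b \<pi> K0 \<le> channel_information b \<pi> K"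
      using subset_channels_attain_min[OF base \<pi>_A \<Gamma>_A] by blast
    have H: "hypergraph_entropy b A \<Gamma> \<pi> = channel_information b \<pi> K0"
      unfolding hypergraph_entropy_def by (rule min_information_eq[OF K0 K0_min])
    have lower: "PA * channel_information b \<pi> K0 \<le> channel_information b P K" if "K \<in> ?T" for K
    proof -
      \<comment> \<open>The largest hyperedge for which \<open>t\<close> is a common reconstruction;
        it contains the input \<open>a\<close> whenever \<open>t \<in> R a\<close>.\<close>
      let ?W = "\<lambda>t. {a \<in> A. t \<in> R a}"
      have "(\<lambda>a. map_pmf ?W (K a)) \<in> subset_channels A \<Gamma> \<pi>"
        using that unfolding subset_channels_iff T set_\<pi> \<Gamma>_def zero_distortion_hypergraph_def
        by fastforce
      then have "channel_information b \<pi> K0 \<le> channel_information b \<pi> (\<lambda>a. map_pmf ?W (K a))"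
        by (rule K0_min)
      also have "\<dots> \<le> channel_information b \<pi> K"
        by (rule channel_information_map_le[OF base])
      finally have "PA * channel_information b \<pi> K0 \<le> PA * channel_information b \<pi> K"
        using PA by simp
      also have "\<dots> \<le> channel_information b P K"
        unfolding PA_def \<pi>_def by (rule channel_information_cond_pmf_le[OF base ne])
      finally show ?thesis .
    qed
    \<comment> \<open>A common reconstruction for each hyperedge. Elsewhere any letter of
      \<open>S'\<close> serves: \<open>K0\<close> may emit non-hyperedges at core inputs of
      probability 0, where test channels must still stay in \<open>S'\<close>.\<close>
    define g where "g W = (SOME t. t \<in> S' \<and> (W \<in> \<Gamma> \<longrightarrow> t \<in> (\<Inter>a\<in>W. R a)))" for W
    have "\<exists>t. t \<in> S' \<and> (W \<in> \<Gamma> \<longrightarrow> t \<in> (\<Inter>a\<in>W. R a))" for W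
    proof (cases "W \<in> \<Gamma>")
      case True
      then obtain t a where "t \<in> (\<Inter>a\<in>W. R a)" "a \<in> W"
        by (auto simp: \<Gamma>_def zero_distortion_hypergraph_def)
      then show ?thesis using R_sub[of a] by blast
    qed (use alphabet in auto)
    then have g: "g W \<in> S' \<and> (W \<in> \<Gamma> \<longrightarrow> g W \<in> (\<Inter>a\<in>W. R a))" for W
      unfolding g_def by (rule someI_ex)
    define L where "L s = map_pmf g (K0 s)" for s
    define K where "K s = (if s \<in> A then L s else bind_pmf \<pi> L)" for s
    have L_S': "set_pmf (L s) \<subseteq> S'" for s using g by (auto simp: L_def)
    have L_R: "set_pmf (L a) \<subseteq> R a" if "a \<in> set_pmf \<pi>" for a
      using g K0 that unfolding L_def subset_channels_iff by fastforce
    \<comment> \<open>The letters emitted outside the core come from sets \<open>R a\<close> with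
      \<open>a\<close> in the core, so every redundant statement accepts them.\<close>
    have "set_pmf (bind_pmf \<pi> L) \<subseteq> S' \<inter> Cn S" using L_R R_sub by fastforce
    then have K: "K \<in> ?T"
      using L_S' L_R R_red source unfolding T K_def set_\<pi> by (simp add: subset_iff)
    have "channel_information b P K \<le> PA * channel_information b \<pi> L"
      unfolding PA_def \<pi>_def K_def[abs_def] by (rule channel_information_extend_le[OF base ne])
    also have "\<dots> \<le> PA * channel_information b \<pi> K0"
      unfolding L_def[abs_def] using PA channel_information_map_le[OF base, of \<pi> g K0] by simp
    \<comment> \<open>The upper bound meets \<open>lower\<close> at \<open>K\<close>, so
      \<open>K\<close> is optimal and the rate-distortion minimum is attained without a further
      compactness argument.\<close>
    finally have "channel_information b P K = PA * channel_information b \<pi> K0"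
      using lower[OF K] by simp
    moreover have "rate_distortion b S S' ?d P 0 = ereal (channel_information b P K)"
      by (rule rate_distortion_eq[OF K]) (use lower calculation in simp)
    ultimately show ?thesis using False H by (simp add: \<Gamma>_def \<pi>_def)
  qed
qed

end
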